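(* Let $B=B'(p)\subseteq\mathbb{R}^S$ be an integral base-polyhedron given by an integer-valued supermodular function $p$. The output $z^*$ of the Groenevelt-type decomposition algorithm (described in the context) applied to $B\cap\mathbb{Z}^S$ is a minimizer of the square-sum $W(x)=\sum_{s\in S}x(s)^2$ over the M-convex set $B\cap\mathbb{Z}^S$; equivalently, $z^*$ is a decreasingly minimal element of $B\cap\mathbb{Z}^S$.
   Context: $S$ is a finite non-empty set. For $x\in\mathbb{R}^S$ and $Z\subseteq S$, $\widetilde x(Z):=\sum_{s\in Z}x(s)$; $\chi_Z$ is the characteristic vector of $Z$. A set-function $p:2^S\to\mathbb{Z}\cup\{-\infty\}$ with $p(\emptyset)=0$ is supermodular if $p(X)+p(Y)\le p(X\cap Y)+p(X\cup Y)$ for all $X,Y$ with finite $p$-values; $p(S)$ is assumed finite. $B'(p):=\{x\in\mathbb{R}^S:\widetilde x(S)=p(S),\ \widetilde x(Z)\ge p(Z)\text{ for every }Z\subset S\}$; the set $B\cap\mathbb{Z}^S$ is called an M-convex set. $Q:=\{y\in\mathbb{R}^S:\widetilde y(X)\ge p(X)\ \forall X\subseteq S\}$. An element $m$ of a set $P$ of vectors is decreasingly minimal (dec-min) in $P$ if the vector of its components sorted in non-increasing order is lexicographically smallest among those of elements of $P$. For $S_+\subseteq S$, the restriction of $B$ to $S_+$ is $B_+:=B'(p_+)$ on ground-set $S_+$, where $p_+(X):=p(X)$ for $X\subseteq S_+$. For $S_-\subseteq S$, the contraction of $B$ to $S_-$ is $B_-:=B'(p_-)$ on ground-set $S_-$,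 where $p_-(X):=p(X\cup(S-S_-))-p(S-S_-)$ for $X\subseteq S_-$. Groenevelt-type decomposition algorithm on $B\cap\mathbb{Z}^S$: 1. Let $a:=\lfloor p(S)/|S|\rfloor$, $k:=p(S)-a|S|$, and $x:=a\chi_S+\chi_U$ for an arbitrary $U\subset S$ with $|U|=k$. 2. If $x\in B\cap\mathbb{Z}^S$, let $z^*:=x$ and stop. 3. Find a (componentwise) minimal vector $y$ satisfying $y\ge x$ and $y\in Q\cap\mathbb{Z}^S$. 4. Let $S_+$ be the largest subset $X\subseteq S$ with $\widetilde y(X)=p(X)$, and let $S_-:=S\setminus S_+$. 5. Apply the algorithm recursively to $B_+\cap\mathbb{Z}^{S_+}$, where $B_+$ is the restriction to $S_+$; let $z^*_+\in\mathbb{Z}^{S_+}$ be the output. 6. Apply the algorithm recursively to $B_-\cap\mathbb{Z}^{S_-}$, where $B_-$ is the contraction to $S_-$; let $z^*_-\in\mathbb{Z}^{S_-}$ be the output. 7. Define $z^*(s):=z^*_+(s)$ for $s\in S_+$ and $z^*(s):=z^*_-(s)$ for $s\in S_-$, and stop. *)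

theory Defs
  imports "HOL-Library.Multiset" "HOL-Library.FuncSet" "HOL-Library.Extended_Real"
begin

text \<open>
  The space \<open>\<real>\<^sup>S\<close> is \<open>S \<rightarrow>\<^sub>E UNIV\<close>, with real values, for a finite set \<open>S\<close>, and \<open>\<int>\<^sup>S\<close> is
  \<open>S \<rightarrow>\<^sub>E \<int>\<close>, where \<open>\<int>\<close> is the set of integers inside the reals.  All vectors of \<open>\<real>\<^sup>S\<close> agree
  outside \<open>S\<close>, so equality and the pointwise order of functions restrict to equality and the
  componentwise order on \<open>\<real>\<^sup>S\<close>.  Set-functions take values in \<^typ>\<open>ereal\<close>, and only their values on
  subsets of the ground-set matter.
\<close>

definition integer_supermodular :: "'a set \<Rightarrow> ('a set \<Rightarrow> ereal) \<Rightarrow> bool" where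
  "integer_supermodular S p \<longleftrightarrow>
     p {} = 0 \<and>
     (\<forall>X\<subseteq>S. p X = -\<infinity> \<or> (\<exists>k::int. p X = ereal (of_int k))) \<and>
     (\<forall>X\<subseteq>S. \<forall>Y\<subseteq>S. p X \<noteq> -\<infinity> \<longrightarrow> p Y \<noteq> -\<infinity> \<longrightarrow> p X + p Y \<le> p (X \<inter> Y) + p (X \<union> Y))"

definition base_polyhedron :: "'a set \<Rightarrow> ('a set \<Rightarrow> ereal) \<Rightarrow> ('a \<Rightarrow> real) set" where
  "base_polyhedron S p =
     {x \<in> S \<rightarrow>\<^sub>E UNIV. ereal (\<Sum>s\<in>S. x s) = p S \<and> (\<forall>Z. Z \<subset> S \<longrightarrow> ereal (\<Sum>s\<in>Z. x s) \<ge> p Z)}"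

definition M_convex_set :: "'a set \<Rightarrow> ('a set \<Rightarrow> ereal) \<Rightarrow> ('a \<Rightarrow> real) set" where
  "M_convex_set S p = base_polyhedron S p \<inter> (S \<rightarrow>\<^sub>E \<int>)"

text \<open>The polyhedron \<open>Q\<close> of the algorithm.\<close>

definition contra_polyhedron :: "'a set \<Rightarrow> ('a set \<Rightarrow> ereal) \<Rightarrow> ('a \<Rightarrow> real) set" where
  "contra_polyhedron S p = {y \<in> S \<rightarrow>\<^sub>E UNIV. \<forall>X\<subseteq>S. ereal (\<Sum>s\<in>X. y s) \<ge> p X}"

definition restriction :: "('a set \<Rightarrow> ereal) \<Rightarrow> 'a set \<Rightarrow> 'a set \<Rightarrow> ereal" where
  "restriction p T = (\<lambda>X\<in>Pow T. p X)"

text \<open>Contraction \<^emph>\<open>to\<close> \<open>T\<close>: the new ground-set is \<open>T\<close>, and \<open>S - T\<close> is contracted.\<close>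

definition contraction :: "'a set \<Rightarrow> ('a set \<Rightarrow> ereal) \<Rightarrow> 'a set \<Rightarrow> 'a set \<Rightarrow> ereal" where
  "contraction S p T = (\<lambda>X\<in>Pow T. p (X \<union> (S - T)) - p (S - T))"

definition starting_vector :: "'a set \<Rightarrow> ('a set \<Rightarrow> ereal) \<Rightarrow> ('a \<Rightarrow> real) \<Rightarrow> bool" where
  "starting_vector S p x \<longleftrightarrow>
     (let a = \<lfloor>real_of_ereal (p S) / real (card S)\<rfloor>;
          k = real_of_ereal (p S) - of_int a * real (card S)
      in \<exists>U. U \<subset> S \<and> real (card U) = k \<and> x = (\<lambda>s\<in>S. of_int a + (if s \<in> U then 1 else 0)))"

definition minimal_vector :: "('a \<Rightarrow> real) set \<Rightarrow> ('a \<Rightarrow> real) \<Rightarrow> bool" where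
  "minimal_vector P y \<longleftrightarrow> y \<in> P \<and> (\<forall>y'\<in>P. y' \<le> y \<longrightarrow> y' = y)"

definition tight_sets :: "'a set \<Rightarrow> ('a set \<Rightarrow> ereal) \<Rightarrow> ('a \<Rightarrow> real) \<Rightarrow> 'a set set" where
  "tight_sets S p y = {X. X \<subseteq> S \<and> ereal (\<Sum>s\<in>X. y s) = p X}"

text \<open>
  The algorithm makes arbitrary choices (of the starting vector and of the minimal vector), so it is
  a relation: \<open>groenevelt S p z\<close> means that some run on ground-set \<open>S\<close> with set-function \<open>p\<close>
  terminates with output \<open>z\<close>.
\<close>

inductive groenevelt :: "'a set \<Rightarrow> ('a set \<Rightarrow> ereal) \<Rightarrow> ('a \<Rightarrow> real) \<Rightarrow> bool" where
  stop: "groenevelt S p x"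
    if "starting_vector S p x"
      and "x \<in> M_convex_set S p"
| decompose: "groenevelt S p (\<lambda>s\<in>S. if s \<in> S\<^sub>p then z\<^sub>p s else z\<^sub>m s)"
    if "starting_vector S p x"
      and "x \<notin> M_convex_set S p"
      and "minimal_vector {y \<in> contra_polyhedron S p \<inter> (S \<rightarrow>\<^sub>E \<int>). x \<le> y} y"
      and "S\<^sub>p \<in> tight_sets S p y"
      and "\<forall>X \<in> tight_sets S p y. X \<subseteq> S\<^sub>p"
      and "S\<^sub>m = S - S\<^sub>p"
      and "groenevelt S\<^sub>p (restriction p S\<^sub>p) z\<^sub>p"
      and "groenevelt S\<^sub>m (contraction S p S\<^sub>m) z\<^sub>m"

definition square_sum :: "'a set \<Rightarrow> ('a \<Rightarrow> real) \<Rightarrow> real" where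
  "square_sum S x = (\<Sum>s\<in>S. (x s)\<^sup>2)"

definition sorted_decreasing :: "'a set \<Rightarrow> ('a \<Rightarrow> real) \<Rightarrow> real list" where
  "sorted_decreasing S x = rev (sorted_list_of_multiset (image_mset x (mset_set S)))"

definition decreasingly_minimal :: "'a set \<Rightarrow> ('a \<Rightarrow> real) set \<Rightarrow> ('a \<Rightarrow> real) \<Rightarrow> bool" where
  "decreasingly_minimal S P m \<longleftrightarrow>
     m \<in> P \<and> (\<forall>x\<in>P. ord_class.lexordp_eq (sorted_decreasing S m) (sorted_decreasing S x))"

end

theory Submission
  imports Defs
begin

text \<open>
  The optimality proof rests on linear programming duality for the excess
  \<open>\<Sum>s\<in>S. (x s - c)\<^sup>+\<close> of a vector over a level \<open>c\<close>.  For every set \<open>X\<close> the excess of a vector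
  \<open>x\<close> of the M-convex set is at least \<open>\<Sum>s\<in>X. (x s - c)\<close>, hence at least \<open>p X - c \<bar>X\<bar>\<close>.  A set \<open>X\<close>
  for which \<open>z\<close> attains this bound certifies that \<open>z\<close> has the least excess over \<open>c\<close>.  A vector
  that has the least excess over every integer level minimizes both objectives: on integers the
  square is a positive combination of the functions \<open>(x - c)\<^sup>+\<close> up to an affine function, and if the
  sorted vector of \<open>x\<close> were lexicographically smaller than that of \<open>z\<close>, then the excess of \<open>z\<close> would
  be larger over the level given by the value of \<open>x\<close> at the first difference
  (\<open>square_sum_le_if_excess_le\<close>, \<open>lexordp_eq_sorted_if_excess_le\<close>).

  So it suffices to show, by induction over the run, that the output has a certificate for every
  integer level (\<open>groenevelt_has_excess_certificate\<close>).  If the run stops at the starting vector, whose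
  values are \<open>a\<close> and \<open>a + 1\<close>, then \<open>S\<close> is a certificate for the levels up to \<open>a\<close> and \<open>{}\<close> for those
  from \<open>a + 1\<close> on.  In a decomposition step the certificates of the two parts can be glued because
  the level \<open>a\<close> separates their outputs: all values on the largest tight set \<open>S\<^sub>+\<close> are at least
  \<open>a\<close>, and all values on its complement \<open>S\<^sub>-\<close> are at most \<open>a + 1\<close>.  The first bound holds since \<open>y \<ge> x \<ge> a\<close> on \<open>S\<^sub>+\<close> shows that the
  restriction has a vector with all values at least \<open>a\<close>, and then the vector of least excess over
  \<open>a\<close> has this property too.  The second holds since \<open>y = x\<close> on \<open>S\<^sub>-\<close>, so that the contracted
  set-function is bounded by \<open>x \<le> a + 1\<close>, and the certificate for the level \<open>a + 1\<close> shows that the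
  excess over it is zero.  For levels up to \<open>a\<close> a certificate is then \<open>S\<^sub>+\<close> together with a
  certificate of the contraction; for higher levels it is a certificate of the restriction.

  Some run exists because all choices can be made and both recursive calls have smaller non-empty
  ground-sets (\<open>largest_tight_set_proper\<close>).
\<close>

section \<open>Supermodular functions and their minors\<close>

lemma integer_supermodular_empty: "integer_supermodular S p \<Longrightarrow> p {} = 0"
  by (simp add: integer_supermodular_def)

lemma integer_supermodular_cases:
  assumes "integer_supermodular S p" "X \<subseteq> S"
  obtains "p X = -\<infinity>" | k :: int where "p X = ereal (of_int k)"
  using assms unfolding integer_supermodular_def by blast

lemma integer_supermodularD:
  assumes "integer_supermodular S p" "X \<subseteq> S" "Y \<subseteq> S" "p X \<noteq> -\<infinity>" "p Y \<noteq> -\<infinity>"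
  shows "p X + p Y \<le> p (X \<inter> Y) + p (X \<union> Y)"
  using assms unfolding integer_supermodular_def by blast

lemma restriction_apply: "X \<subseteq> T \<Longrightarrow> restriction p T X = p X"
  by (simp add: restriction_def)

lemma contraction_apply: "R \<subseteq> S \<Longrightarrow> X \<subseteq> S - R \<Longrightarrow> contraction S p (S - R) X = p (X \<union> R) - p R"
  by (simp add: contraction_def double_diff)

lemma integer_supermodular_restriction:
  assumes "integer_supermodular S p" "T \<subseteq> S"
  shows "integer_supermodular T (restriction p T)"
proof -
  have "X \<inter> Y \<subseteq> T" "X \<union> Y \<subseteq> T" "X \<subseteq> S" "Y \<subseteq> S" if "X \<subseteq> T" "Y \<subseteq> T" for X Y
    using that assms(2) by auto
  then show ?thesis
    using assms by (simp add: integer_supermodular_def restriction_apply)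
qed

lemma integer_supermodular_contraction:
  assumes p: "integer_supermodular S p" and R: "R \<subseteq> S" and fin: "p R \<noteq> -\<infinity>"
  shows "integer_supermodular (S - R) (contraction S p (S - R))"
proof -
  obtain r :: int where r: "p R = ereal (of_int r)"
    using integer_supermodular_cases[OF p R] fin by metis
  let ?q = "contraction S p (S - R)"
  have q: "?q X = p (X \<union> R) - ereal (of_int r)" if "X \<subseteq> S - R" for X
    using that by (simp add: contraction_apply[OF R] r)
  have vals: "?q X = -\<infinity> \<or> (\<exists>k::int. ?q X = ereal (of_int k))" if X: "X \<subseteq> S - R" for X
  proof -
    have "X \<union> R \<subseteq> S"
      using X R by auto
    with p show ?thesis
    proof (cases rule: integer_supermodular_cases)
      case (2 k)
      then have "?q X = ereal (of_int (k - r))"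
        by (simp add: q[OF X])
      then show ?thesis by blast
    qed (simp add: q[OF X])
  qed
  have super: "?q X + ?q Y \<le> ?q (X \<inter> Y) + ?q (X \<union> Y)"
    if X: "X \<subseteq> S - R" and Y: "Y \<subseteq> S - R" and "?q X \<noteq> -\<infinity>" "?q Y \<noteq> -\<infinity>" for X Y
  proof -
    have sub: "X \<union> R \<subseteq> S" "Y \<union> R \<subseteq> S" "X \<inter> Y \<subseteq> S - R" "X \<union> Y \<subseteq> S - R"
      using X Y R by auto
    have "p (X \<union> R) \<noteq> -\<infinity>" "p (Y \<union> R) \<noteq> -\<infinity>"
      using that by (auto simp: q)
    then have "p (X \<union> R) + p (Y \<union> R) \<le> p ((X \<union> R) \<inter> (Y \<union> R)) + p ((X \<union> R) \<union> (Y \<union> R))"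
      using integer_supermodularD[OF p] sub by blast
    moreover have "(X \<union> R) \<inter> (Y \<union> R) = (X \<inter> Y) \<union> R" "(X \<union> R) \<union> (Y \<union> R) = (X \<union> Y) \<union> R"
      by auto
    ultimately show ?thesis
      unfolding q[OF X] q[OF Y] q[OF sub(3)] q[OF sub(4)]
      by (cases "p (X \<union> R)"; cases "p (Y \<union> R)"; cases "p ((X \<inter> Y) \<union> R)"; cases "p ((X \<union> Y) \<union> R)") auto
  qed
  have "?q {} = 0"
    by (simp add: contraction_apply[OF R] r)
  with vals super show ?thesis
    unfolding integer_supermodular_def by blast
qed

lemma M_convex_set_iff:
  "x \<in> M_convex_set S p \<longleftrightarrow>
     x \<in> S \<rightarrow>\<^sub>E \<int> \<and> ereal (sum x S) = p S \<and> (\<forall>Z\<subseteq>S. p Z \<le> ereal (sum x Z))"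
proof -
  have "x \<in> M_convex_set S p \<longleftrightarrow>
      x \<in> S \<rightarrow>\<^sub>E \<int> \<and> ereal (sum x S) = p S \<and> (\<forall>Z. Z \<subset> S \<longrightarrow> p Z \<le> ereal (sum x Z))"
    unfolding M_convex_set_def base_polyhedron_def Int_iff mem_Collect_eq PiE_iff by simp metis
  also have "\<dots> \<longleftrightarrow> x \<in> S \<rightarrow>\<^sub>E \<int> \<and> ereal (sum x S) = p S \<and> (\<forall>Z\<subseteq>S. p Z \<le> ereal (sum x Z))"
    unfolding psubset_eq by (metis order.refl)
  finally show ?thesis .
qed

lemma sum_glue:
  assumes "finite S" "Z \<subseteq> S"
  shows "sum (\<lambda>s\<in>S. if s \<in> R then u s else v s) Z = sum u (Z \<inter> R) + (sum v (Z - R) :: real)"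
proof -
  have fin: "finite Z"
    using assms finite_subset by blast
  have "sum (\<lambda>s\<in>S. if s \<in> R then u s else v s) Z = (\<Sum>s\<in>Z. if s \<in> R then u s else v s)"
    using assms(2) by (intro sum.cong) auto
  also have "\<dots> = sum u (Z \<inter> R) + sum v (Z \<inter> - R)"
    using sum.If_cases[OF fin, of "\<lambda>s. s \<in> R" u v] by simp
  finally show ?thesis
    by (simp add: Diff_eq)
qed

text \<open>
  For \<open>Z \<subseteq> S\<close>, the glued vector has at least \<open>p (Z \<inter> R) + p (Z \<union> R) - p R\<close> on \<open>Z\<close>, and
  supermodularity for \<open>Z\<close> and \<open>R\<close> bounds this below by \<open>p Z\<close>.
\<close>
lemma M_convex_set_glue:
  assumes S: "finite S" and p: "integer_supermodular S p" and R: "R \<subseteq> S" and fin: "p R \<noteq> -\<infinity>"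
    and u: "u \<in> M_convex_set R (restriction p R)"
    and v: "v \<in> M_convex_set (S - R) (contraction S p (S - R))"
  shows "(\<lambda>s\<in>S. if s \<in> R then u s else v s) \<in> M_convex_set S p" (is "?z \<in> _")
proof -
  obtain r :: int where r: "p R = ereal (of_int r)"
    using integer_supermodular_cases[OF p R] fin by metis
  have u1: "u \<in> R \<rightarrow>\<^sub>E \<int>" and u2: "sum u R = of_int r"
    and u3: "\<And>Z. Z \<subseteq> R \<Longrightarrow> p Z \<le> ereal (sum u Z)"
    using u by (auto simp: M_convex_set_iff restriction_apply r)
  have v1: "v \<in> (S - R) \<rightarrow>\<^sub>E \<int>" and v2: "ereal (sum v (S - R)) = p S - ereal (of_int r)"
    and v3: "\<And>Z. Z \<subseteq> S - R \<Longrightarrow> p (Z \<union> R) - ereal (of_int r) \<le> ereal (sum v Z)"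
    using v R by (auto simp: M_convex_set_iff contraction_apply r Un_absorb2)
  have "?z \<in> S \<rightarrow>\<^sub>E \<int>"
    using u1 v1 by (auto simp: PiE_iff)
  moreover have "ereal (sum ?z S) = p S"
  proof -
    have "sum ?z S = of_int r + sum v (S - R)"
      using sum_glue[OF S order.refl, where R = R and u = u and v = v] u2 R by (simp add: Int_absorb1)
    with v2 show ?thesis
      by (cases "p S") auto
  qed
  moreover have "p Z \<le> ereal (sum ?z Z)" if Z: "Z \<subseteq> S" for Z
  proof (cases "p Z = -\<infinity>")
    case False
    have "p Z + p R \<le> p (Z \<inter> R) + p (Z \<union> R)"
      using integer_supermodularD[OF p Z R False fin] .
    moreover have "p (Z \<inter> R) \<le> ereal (sum u (Z \<inter> R))"
      by (intro u3) auto
    moreover have "p (Z \<union> R) - ereal (of_int r) \<le> ereal (sum v (Z - R))"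
      using v3[of "Z - R"] Z by auto
    ultimately show ?thesis
      unfolding sum_glue[OF S Z] r
      by (cases "p Z"; cases "p (Z \<inter> R)"; cases "p (Z \<union> R)") auto
  qed simp
  ultimately show ?thesis
    by (simp add: M_convex_set_iff)
qed

section \<open>Excess over a level and its dual certificates\<close>

definition excess :: "'a set \<Rightarrow> ('a \<Rightarrow> real) \<Rightarrow> real \<Rightarrow> real" where
  "excess S x c = (\<Sum>s\<in>S. max 0 (x s - c))"

text \<open>
  Complementary slackness: for \<open>z\<close> in the M-convex set, the equation holds exactly when \<open>X\<close> is tight
  for \<open>z\<close>, contains all elements of value above \<open>c\<close> and none of value below \<open>c\<close>.
\<close>
definition excess_certificate :: "'a set \<Rightarrow> ('a set \<Rightarrow> ereal) \<Rightarrow> ('a \<Rightarrow> real) \<Rightarrow> real \<Rightarrow> 'a set \<Rightarrow> bool"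
  where "excess_certificate S p z c X \<longleftrightarrow> X \<subseteq> S \<and> ereal (excess S z c + c * real (card X)) = p X"

lemma sum_le_excess:
  assumes "finite S" "X \<subseteq> S"
  shows "sum x X \<le> excess S x c + c * real (card X)"
proof -
  have "sum x X - c * real (card X) = (\<Sum>s\<in>X. x s - c)"
    by (simp add: sum_subtractf)
  also have "\<dots> \<le> (\<Sum>s\<in>X. max 0 (x s - c))"
    by (intro sum_mono) auto
  also have "\<dots> \<le> excess S x c"
    unfolding excess_def using assms by (intro sum_mono2) auto
  finally show ?thesis by simp
qed

text \<open>
  Weak duality: \<open>p X \<le> \<Sum>s\<in>X. x s\<close>, and the excess of \<open>x\<close> over \<open>c\<close> cannot be less than
  \<open>\<Sum>s\<in>X. (x s - c)\<close>.
\<close>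
lemma excess_certificate_least:
  assumes "finite S" "excess_certificate S p z c X" "x \<in> M_convex_set S p"
  shows "excess S z c \<le> excess S x c"
proof -
  have X: "X \<subseteq> S" and eq: "ereal (excess S z c + c * real (card X)) = p X"
    using assms(2) by (auto simp: excess_certificate_def)
  have "p X \<le> ereal (sum x X)"
    using assms(3) X by (simp add: M_convex_set_iff)
  also have "\<dots> \<le> ereal (excess S x c + c * real (card X))"
    using sum_le_excess[OF assms(1) X] by simp
  finally show ?thesis
    unfolding eq[symmetric] by simp
qed

lemma excess_eq_0: "(\<And>s. s \<in> S \<Longrightarrow> x s \<le> c) \<Longrightarrow> excess S x c = 0"
  by (auto simp: excess_def intro!: sum.neutral)

lemma excess_eq_sum:
  assumes "\<And>s. s \<in> S \<Longrightarrow> c \<le> x s"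
  shows "excess S x c = sum x S - c * real (card S)"
proof -
  have "excess S x c = (\<Sum>s\<in>S. x s - c)"
    unfolding excess_def using assms by (intro sum.cong) auto
  then show ?thesis
    by (simp add: sum_subtractf)
qed

lemma excess_nonneg: "0 \<le> excess S x c"
  by (simp add: excess_def sum_nonneg)

lemma le_level_if_excess_le_0:
  assumes "finite S" "excess S x c \<le> 0" "s \<in> S"
  shows "x s \<le> c"
proof -
  have "(\<Sum>s\<in>S. max 0 (x s - c)) = 0"
    using assms(2) excess_nonneg[of S x c] by (simp add: excess_def)
  then have "max 0 (x s - c) = 0"
    using assms by (simp add: sum_nonneg_eq_0_iff)
  then show ?thesis by simp
qed

text \<open>
  The excess over \<open>c\<close> exceeds \<open>\<Sum>s\<in>S. (x s - c)\<close> by the total amount by which components fall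
  short of \<open>c\<close>.
\<close>
lemma level_le_if_excess_le_sum:
  assumes "finite S" "excess S x c \<le> sum x S - c * real (card S)" "s \<in> S"
  shows "c \<le> x s"
proof -
  have "(\<Sum>s\<in>S. max 0 (x s - c) - (x s - c)) = excess S x c - (sum x S - c * real (card S))"
    by (simp add: excess_def sum_subtractf)
  also have "\<dots> \<le> 0"
    using assms(2) by simp
  finally have "(\<Sum>s\<in>S. max 0 (x s - c) - (x s - c)) = 0"
    by (intro antisym sum_nonneg) auto
  then have "max 0 (x s - c) - (x s - c) = 0"
    using assms sum_nonneg_eq_0_iff[of S "\<lambda>s. max 0 (x s - c) - (x s - c)"] by auto
  then show ?thesis by simp
qed

lemma excess_glue:
  assumes "finite S" "R \<subseteq> S"
  shows "excess S (\<lambda>s\<in>S. if s \<in> R then u s else v s) c = excess R u c + excess (S - R) v c"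
proof -
  let ?z = "\<lambda>s\<in>S. if s \<in> R then u s else v s"
  have "excess S ?z c = excess (S - R) ?z c + excess R ?z c"
    unfolding excess_def using assms by (rule sum.subset_diff[rotated])
  also have "excess R ?z c = excess R u c"
    unfolding excess_def using assms(2) by (intro sum.cong) auto
  also have "excess (S - R) ?z c = excess (S - R) v c"
    unfolding excess_def by (intro sum.cong) auto
  finally show ?thesis
    by (simp only: add.commute)
qed

section \<open>Least excess at every level means optimality\<close>

text \<open>
  The terms with \<open>i < n\<close> are \<open>n, \<dots>, 1\<close> and the others vanish.  As \<open>n (n + 1) / 2\<close> is \<open>v\<^sup>2 / 2\<close> up to
  an affine function of \<open>v\<close>, this writes the square as a positive combination of the functions
  \<open>(v - c)\<^sup>+\<close> over integer levels \<open>c\<close>.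
\<close>
lemma sum_levels:
  fixes v :: real
  assumes "v = of_int m + real n" "n \<le> N"
  shows "(\<Sum>i<N. max 0 (v - (of_int m + real i))) = (real n * (real n + 1)) / 2"
proof -
  have "(\<Sum>i<N. max 0 (v - (of_int m + real i))) = (\<Sum>i<n. max 0 (v - (of_int m + real i)))"
    using assms by (intro sum.mono_neutral_right) auto
  also have "\<dots> = (\<Sum>i<n. real n - real i)"
    using assms by (intro sum.cong) auto
  also have "\<dots> = (real n * (real n + 1)) / 2"
  proof (induction n)
    case (Suc n)
    have "(\<Sum>i<Suc n. real (Suc n) - real i) = (\<Sum>i<n. (real n - real i) + 1) + 1"
      by (simp add: algebra_simps)
    also have "\<dots> = (\<Sum>i<n. real n - real i) + real n + 1"
      by (simp add: sum.distrib)
    finally show ?case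
      using Suc by (simp add: field_simps)
  qed simp
  finally show ?thesis .
qed

text \<open>
  The affine part of the square contributes the same to both square-sums because the totals agree.
\<close>
lemma square_sum_le_if_excess_le:
  assumes S: "finite S" and z: "z \<in> S \<rightarrow>\<^sub>E \<int>" and x: "x \<in> S \<rightarrow>\<^sub>E \<int>"
    and total: "sum z S = sum x S"
    and le: "\<And>c. c \<in> \<int> \<Longrightarrow> excess S z c \<le> excess S x c"
  shows "square_sum S z \<le> square_sum S x"
proof -
  define B where "B = (\<Sum>s\<in>S. \<bar>z s\<bar> + \<bar>x s\<bar>)"
  have bound: "\<bar>z s\<bar> + \<bar>x s\<bar> \<le> B" if "s \<in> S" for s
    unfolding B_def using that S by (intro member_le_sum) auto
  \<comment> \<open>All components lie between \<open>m\<close> and \<open>m + N\<close>, so the levels \<open>m, \<dots>, m + N - 1\<close> suffice.\<close>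
  obtain m :: int where m: "of_int m \<le> - B"
    using of_int_floor_le by blast
  obtain N :: nat where N: "B - of_int m \<le> real N"
    using real_arch_simple by blast
  have square: "square_sum S w = 2 * (\<Sum>i<N. excess S w (of_int m + real i))
      + (2 * of_int m - 1) * sum w S - (of_int m * of_int m - of_int m) * real (card S)"
    if w: "w \<in> S \<rightarrow>\<^sub>E \<int>" and wb: "\<And>s. s \<in> S \<Longrightarrow> \<bar>w s\<bar> \<le> B" for w
  proof -
    have point: "(w s)\<^sup>2 = 2 * (\<Sum>i<N. max 0 (w s - (of_int m + real i)))
        + (2 * of_int m - 1) * w s - (of_int m * of_int m - of_int m)" if s: "s \<in> S" for s
    proof -
      obtain k :: int where k: "w s = of_int k"
        using w s by (metis Ints_cases PiE_mem)
      have "real_of_int m \<le> of_int k"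
        using wb[OF s] m k by linarith
      then have n: "w s = of_int m + real (nat (k - m))"
        by (simp add: k)
      have "real (nat (k - m)) \<le> real N"
        using wb[OF s] N n by linarith
      then have "nat (k - m) \<le> N"
        by simp
      then have "(\<Sum>i<N. max 0 (w s - (of_int m + real i)))
          = (w s - of_int m) * (w s - of_int m + 1) / 2"
        using sum_levels[OF n] n by simp
      then show ?thesis
        by (simp add: power2_eq_square algebra_simps)
    qed
    have "square_sum S w = (\<Sum>s\<in>S. 2 * (\<Sum>i<N. max 0 (w s - (of_int m + real i)))
        + (2 * of_int m - 1) * w s - (of_int m * of_int m - of_int m))"
      unfolding square_sum_def by (intro sum.cong refl point)
    also have "\<dots> = 2 * (\<Sum>s\<in>S. \<Sum>i<N. max 0 (w s - (of_int m + real i)))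
        + (2 * of_int m - 1) * sum w S - (of_int m * of_int m - of_int m) * real (card S)"
      by (simp add: sum.distrib sum_subtractf sum_distrib_left)
    also have "(\<Sum>s\<in>S. \<Sum>i<N. max 0 (w s - (of_int m + real i)))
        = (\<Sum>i<N. excess S w (of_int m + real i))"
      unfolding excess_def by (rule sum.swap)
    finally show ?thesis .
  qed
  have "(\<Sum>i<N. excess S z (of_int m + real i)) \<le> (\<Sum>i<N. excess S x (of_int m + real i))"
    by (intro sum_mono le) auto
  moreover have "\<bar>z s\<bar> \<le> B" "\<bar>x s\<bar> \<le> B" if "s \<in> S" for s
    using bound[OF that] by linarith+
  ultimately show ?thesis
    using square[OF z] square[OF x] total by simp
qed

lemma excess_eq_sum_list:
  "excess S x c = (\<Sum>t\<leftarrow>sorted_decreasing S x. max 0 (t - c))"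
proof -
  have "(\<Sum>t\<leftarrow>sorted_decreasing S x. max 0 (t - c))
      = sum_mset (image_mset (\<lambda>t. max 0 (t - c)) (mset (sorted_decreasing S x)))"
    by (metis mset_map sum_mset_sum_list)
  also have "mset (sorted_decreasing S x) = image_mset x (mset_set S)"
    by (simp add: sorted_decreasing_def)
  finally show ?thesis
    by (simp add: excess_def sum_unfold_sum_mset image_mset.compositionality comp_def)
qed

text \<open>
  If the conclusion fails, the sorted vectors first differ at a place where \<open>x\<close> has a value \<open>b\<close>
  smaller than the value of \<open>z\<close>.  All later values of \<open>x\<close> are at most \<open>b\<close>, so over the level \<open>b\<close>
  the excess of \<open>z\<close> is larger.
\<close>
lemma lexordp_eq_sorted_if_excess_le:
  assumes S: "finite S" and x: "x \<in> S \<rightarrow>\<^sub>E \<int>"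
    and le: "\<And>c. c \<in> \<int> \<Longrightarrow> excess S z c \<le> excess S x c"
  shows "ord_class.lexordp_eq (sorted_decreasing S z) (sorted_decreasing S x)"
proof (rule ccontr)
  let ?zs = "sorted_decreasing S z" and ?xs = "sorted_decreasing S x"
  assume "\<not> ord_class.lexordp_eq ?zs ?xs"
  then have "ord_class.lexordp ?xs ?zs"
    using lexordp_linear lexordp_into_lexordp_eq lexordp_eq_refl by metis
  moreover have "length ?xs = length ?zs"
    by (simp add: sorted_decreasing_def flip: size_mset)
  ultimately obtain us b d vs ws where bd: "b < d" and xs: "?xs = us @ b # vs"
    and zs: "?zs = us @ d # ws"
    by (auto simp: lexordp_iff)
  have "b \<in> set ?xs"
    by (simp add: xs)
  then have "b \<in> x ` S"
    using S by (simp add: sorted_decreasing_def)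
  then have "b \<in> \<int>"
    using x by (auto simp: PiE_iff)
  have "sorted_wrt (\<ge>) ?xs"
    by (simp add: sorted_decreasing_def sorted_wrt_rev)
  then have "\<forall>t\<in>set vs. t \<le> b"
    by (simp add: xs sorted_wrt_append)
  then have "(\<Sum>t\<leftarrow>vs. max 0 (t - b)) = 0"
    by (induction vs) auto
  then have "excess S x b = (\<Sum>t\<leftarrow>us. max 0 (t - b))"
    by (simp add: excess_eq_sum_list xs)
  moreover have "0 \<le> (\<Sum>t\<leftarrow>ws. max 0 (t - b))"
    by (intro sum_list_nonneg) auto
  then have "excess S z b > (\<Sum>t\<leftarrow>us. max 0 (t - b))"
    using bd by (simp add: excess_eq_sum_list zs)
  ultimately show False
    using le[OF \<open>b \<in> \<int>\<close>] by simp
qed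

section \<open>One step of the algorithm\<close>

lemma starting_vectorE:
  assumes S: "finite S" and x: "starting_vector S p x"
  obtains a :: int where "x \<in> S \<rightarrow>\<^sub>E \<int>" "sum x S = real_of_ereal (p S)"
    "\<And>s. s \<in> S \<Longrightarrow> of_int a \<le> x s" "\<And>s. s \<in> S \<Longrightarrow> x s \<le> of_int (a + 1)" "S \<noteq> {}"
proof -
  define a where "a = \<lfloor>real_of_ereal (p S) / real (card S)\<rfloor>"
  obtain U where U: "U \<subset> S" and card: "real (card U) = real_of_ereal (p S) - of_int a * real (card S)"
    and x_def: "x = (\<lambda>s\<in>S. of_int a + (if s \<in> U then 1 else 0))"
    using x unfolding starting_vector_def Let_def a_def by blast
  have "sum x S = (\<Sum>s\<in>S. of_int a + (if s \<in> U then 1 else 0))"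
    unfolding x_def by (intro sum.cong) auto
  also have "\<dots> = of_int a * real (card S) + real (card (S \<inter> U))"
    using S by (simp add: sum.distrib sum.If_cases)
  also have "S \<inter> U = U"
    using U by auto
  finally have "sum x S = real_of_ereal (p S)"
    using card by simp
  then show thesis
    using U by (intro that[of a]) (auto simp: x_def)
qed

lemma starting_vector_exists:
  assumes S: "finite S" "S \<noteq> {}" and p: "integer_supermodular S p"
  shows "\<exists>x. starting_vector S p x"
proof -
  obtain k :: int where k: "real_of_ereal (p S) = of_int k"
    using integer_supermodular_cases[OF p order.refl]
    by (metis of_int_0 real_of_ereal.simps(1) real_of_ereal.simps(3))
  have n: "card S > 0"
    using S by (simp add: card_gt_0_iff)
  have a: "\<lfloor>real_of_ereal (p S) / real (card S)\<rfloor> = k div int (card S)"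
    unfolding k by (metis floor_divide_of_int_eq of_int_of_nat_eq)
  have "k - k div int (card S) * int (card S) = k mod int (card S)"
    by (simp add: minus_div_mult_eq_mod)
  then have r: "real_of_int k - of_int (k div int (card S)) * real (card S) = of_int (k mod int (card S))"
    by (metis of_int_diff of_int_mult of_int_of_nat_eq)
  have lt: "k mod int (card S) < int (card S)" "0 \<le> k mod int (card S)"
    using n by simp_all
  then have "nat (k mod int (card S)) < card S"
    by linarith
  then obtain U where U: "U \<subseteq> S" "card U = nat (k mod int (card S))"
    by (metis less_imp_le obtain_subset_with_card_n)
  then have "U \<subset> S"
    using \<open>nat (k mod int (card S)) < card S\<close> by auto
  moreover have "real (card U) = of_int k - of_int (k div int (card S)) * real (card S)"
    using U lt by (simp add: r)
  ultimately show ?thesis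
    unfolding starting_vector_def Let_def a unfolding k by (metis (no_types))
qed

text \<open>
  A large constant vector lies in the set, and the integral vectors between \<open>x\<close> and it are well
  founded under the componentwise order, by the sum of their components.
\<close>
lemma minimal_vector_exists:
  assumes S: "finite S" and p: "integer_supermodular S p" and x: "x \<in> S \<rightarrow>\<^sub>E \<int>"
  shows "\<exists>y. minimal_vector {y \<in> contra_polyhedron S p \<inter> (S \<rightarrow>\<^sub>E \<int>). x \<le> y} y"
    (is "\<exists>y. minimal_vector ?P y")
proof -
  define B where "B = (\<Sum>X\<in>Pow S. \<bar>real_of_ereal (p X)\<bar>) + (\<Sum>s\<in>S. \<bar>x s\<bar>)"
  define b :: real where "b = of_int \<lceil>B\<rceil>"
  have "B \<le> b" "b \<in> \<int>"
    unfolding b_def by auto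
  have "\<bar>real_of_ereal (p X)\<bar> \<le> (\<Sum>X\<in>Pow S. \<bar>real_of_ereal (p X)\<bar>)" if "X \<subseteq> S" for X
    using S that by (intro member_le_sum abs_ge_zero) auto
  moreover have "0 \<le> (\<Sum>s\<in>S. \<bar>x s\<bar>)"
    by (intro sum_nonneg) auto
  ultimately have pb: "\<bar>real_of_ereal (p X)\<bar> \<le> b" if "X \<subseteq> S" for X
    using \<open>B \<le> b\<close> that unfolding B_def by (meson add_increasing2 order.trans)
  have "\<bar>x s\<bar> \<le> (\<Sum>s\<in>S. \<bar>x s\<bar>)" if "s \<in> S" for s
    using S that by (intro member_le_sum abs_ge_zero) auto
  moreover have "0 \<le> (\<Sum>X\<in>Pow S. \<bar>real_of_ereal (p X)\<bar>)"
    by (intro sum_nonneg abs_ge_zero)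
  ultimately have xb: "x s \<le> b" if "s \<in> S" for s
    using \<open>B \<le> b\<close> that unfolding B_def by (meson abs_le_D1 add_increasing order.trans)
  let ?y = "\<lambda>s\<in>S. b"
  have "p X \<le> ereal (sum ?y X)" if X: "X \<subseteq> S" for X
  proof (cases "X = {}")
    case True
    then show ?thesis
      by (simp add: integer_supermodular_empty[OF p] zero_ereal_def)
  next
    case False
    have "sum ?y X = (\<Sum>s\<in>X. b)"
      using X by (intro sum.cong) auto
    also have "\<dots> = real (card X) * b"
      by simp
    finally have sum: "sum ?y X = real (card X) * b" .
    have "1 \<le> card X"
      using False X S by (simp add: Suc_le_eq card_gt_0_iff finite_subset)
    then have "1 * b \<le> real (card X) * b"
      using order.trans[OF abs_ge_zero pb[OF X]] by (intro mult_right_mono) auto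
    from p X show ?thesis
    proof (cases rule: integer_supermodular_cases)
      case (2 k)
      then show ?thesis
        using pb[OF X] \<open>1 * b \<le> _\<close> unfolding sum by simp
    qed simp
  qed
  then have "?y \<in> ?P"
    using xb x \<open>b \<in> \<int>\<close> by (auto simp: contra_polyhedron_def le_fun_def PiE_iff extensional_def)
  then obtain y where y: "y \<in> ?P"
    and least: "\<And>y'. y' \<in> ?P \<Longrightarrow> nat \<lfloor>sum y S - sum x S\<rfloor> \<le> nat \<lfloor>sum y' S - sum x S\<rfloor>"
    using ex_has_least_nat[of "\<lambda>y. y \<in> ?P" ?y "\<lambda>y. nat \<lfloor>sum y S - sum x S\<rfloor>"] by blast
  have "y' = y" if y': "y' \<in> ?P" and le: "y' \<le> y" for y'
  proof -
    have ints: "sum x S \<in> \<int>" "sum y S \<in> \<int>" "sum y' S \<in> \<int>"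
      using x y y' by (auto intro!: Ints_sum)
    have "sum x S \<le> sum y' S"
      using y' by (intro sum_mono) (auto simp: le_fun_def)
    moreover have "sum y' S \<le> sum y S"
      using le by (intro sum_mono) (auto simp: le_fun_def)
    moreover obtain i j k :: int where "sum x S = of_int i" "sum y S = of_int j" "sum y' S = of_int k"
      using ints by (auto elim!: Ints_cases)
    ultimately have "sum y' S = sum y S"
      using least[OF y'] by (simp flip: of_int_diff)
    then have "(\<Sum>s\<in>S. y s - y' s) = 0"
      by (simp add: sum_subtractf)
    moreover have "0 \<le> y s - y' s" for s
      using le by (simp add: le_fun_def)
    ultimately have "\<forall>s\<in>S. y s - y' s = 0"
      using S by (subst (asm) sum_nonneg_eq_0_iff) auto
    then show ?thesis
      using y y' by (intro extensionalityI[of _ S]) (auto simp: PiE_iff)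
  qed
  then show ?thesis
    using y unfolding minimal_vector_def by blast
qed

text \<open>
  Lowering an integral \<open>y\<close> by one at an element \<open>s\<close> of no tight set keeps it in \<open>Q\<close>, because the
  slack of every set that contains \<open>s\<close> is a positive integer or infinite.  Minimality thus forces
  \<open>y s = x s\<close>.
\<close>
lemma minimal_vector_eq_outside_tight_sets:
  assumes S: "finite S" and p: "integer_supermodular S p" and x: "x \<in> S \<rightarrow>\<^sub>E \<int>"
    and y: "minimal_vector {y \<in> contra_polyhedron S p \<inter> (S \<rightarrow>\<^sub>E \<int>). x \<le> y} y"
    and s: "s \<in> S" "s \<notin> \<Union> (tight_sets S p y)"
  shows "y s = x s"
proof (rule ccontr)
  assume "y s \<noteq> x s"
  have yZ: "y \<in> S \<rightarrow>\<^sub>E \<int>" and "x \<le> y" and yQ: "\<And>X. X \<subseteq> S \<Longrightarrow> p X \<le> ereal (sum y X)"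
    using y by (auto simp: minimal_vector_def contra_polyhedron_def)
  obtain i j :: int where ij: "x s = of_int i" "y s = of_int j"
    using x yZ s(1) by (metis Ints_cases PiE_mem)
  moreover have "x s \<le> y s"
    using \<open>x \<le> y\<close> by (simp add: le_fun_def)
  ultimately have "i + 1 \<le> j"
    using \<open>y s \<noteq> x s\<close> by simp
  then have "of_int (i + 1) \<le> real_of_int j"
    by (simp only: of_int_le_iff)
  then have less: "x s \<le> y s - 1"
    by (simp add: ij)
  let ?y = "y(s := y s - 1)"
  have "p X \<le> ereal (sum ?y X)" if X: "X \<subseteq> S" for X
  proof (cases "s \<in> X")
    case True
    have fin: "finite X"
      using X S finite_subset by blast
    have sum: "sum ?y X = sum y X - 1"
      using True fin by (simp add: sum.remove[of X s])
    have "ereal (sum y X) \<noteq> p X"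
      using s(2) True X by (auto simp: tight_sets_def)
    have "sum y X \<in> \<int>"
      using yZ X by (intro Ints_sum) auto
    from p X show ?thesis
    proof (cases rule: integer_supermodular_cases)
      case (2 k)
      then have "of_int k < sum y X"
        using yQ[OF X] \<open>ereal (sum y X) \<noteq> p X\<close> by auto
      moreover obtain l :: int where l: "sum y X = of_int l"
        using \<open>sum y X \<in> \<int>\<close> Ints_cases by metis
      ultimately have "k + 1 \<le> l"
        by simp
      then have "of_int (k + 1) \<le> real_of_int l"
        by (simp only: of_int_le_iff)
      then have "of_int k \<le> sum y X - 1"
        by (simp add: l)
      then show ?thesis
        unfolding 2 sum by simp
    qed simp
  next
    case False
    then have "sum ?y X = sum y X"
      by (intro sum.cong) auto
    then show ?thesis
      using yQ[OF X] by simp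
  qed
  moreover have "?y \<in> S \<rightarrow>\<^sub>E \<int>"
    using yZ s(1) by (auto simp: PiE_iff extensional_def)
  moreover have "x \<le> ?y"
    using \<open>x \<le> y\<close> less by (simp add: le_fun_def)
  moreover have "?y \<le> y"
    by (simp add: le_fun_def)
  ultimately have "?y = y"
    using y unfolding minimal_vector_def contra_polyhedron_def by (auto simp: PiE_iff)
  then have "y s - 1 = y s"
    by (metis fun_upd_same)
  then show False
    by simp
qed

text \<open>
  The slack of \<open>y\<close> is a non-negative submodular set-function, so its zeros are closed under union.
\<close>
lemma tight_sets_Un:
  assumes S: "finite S" and p: "integer_supermodular S p" and y: "y \<in> contra_polyhedron S p"
    and X: "X \<in> tight_sets S p y" and Y: "Y \<in> tight_sets S p y"
  shows "X \<union> Y \<in> tight_sets S p y"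
proof -
  have sub: "X \<subseteq> S" "Y \<subseteq> S" "X \<inter> Y \<subseteq> S" "X \<union> Y \<subseteq> S"
    and eq: "p X = ereal (sum y X)" "p Y = ereal (sum y Y)"
    using X Y by (auto simp: tight_sets_def)
  have fin: "finite X" "finite Y"
    using sub S finite_subset by blast+
  have "ereal (sum y X) + ereal (sum y Y) \<le> p (X \<inter> Y) + p (X \<union> Y)"
    using integer_supermodularD[OF p sub(1,2)] by (simp add: eq)
  moreover have "p (X \<inter> Y) \<le> ereal (sum y (X \<inter> Y))" "p (X \<union> Y) \<le> ereal (sum y (X \<union> Y))"
    using y sub by (auto simp: contra_polyhedron_def)
  moreover have "sum y (X \<union> Y) + sum y (X \<inter> Y) = sum y X + sum y Y"
    using sum.union_inter[OF fin] .
  ultimately have "ereal (sum y (X \<union> Y)) = p (X \<union> Y)"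
    by (cases "p (X \<inter> Y)"; cases "p (X \<union> Y)") auto
  then show ?thesis
    using sub by (simp add: tight_sets_def)
qed

lemma largest_tight_set_exists:
  assumes S: "finite S" and p: "integer_supermodular S p" and y: "y \<in> contra_polyhedron S p"
  shows "\<exists>R. R \<in> tight_sets S p y \<and> (\<forall>X\<in>tight_sets S p y. X \<subseteq> R)"
proof -
  have "finite (tight_sets S p y)"
    by (rule finite_subset[of _ "Pow S"]) (use S in \<open>auto simp: tight_sets_def\<close>)
  moreover have "{} \<in> tight_sets S p y"
    by (simp add: tight_sets_def integer_supermodular_empty[OF p] zero_ereal_def)
  ultimately obtain R where R: "R \<in> tight_sets S p y"
    and max: "\<And>X. X \<in> tight_sets S p y \<Longrightarrow> R \<subseteq> X \<Longrightarrow> R = X"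
    using finite_has_maximal[of "tight_sets S p y"] by auto
  have "X \<subseteq> R" if "X \<in> tight_sets S p y" for X
    using max[OF tight_sets_Un[OF S p y R that]] by auto
  with R show ?thesis by blast
qed

text \<open>
  If the largest tight set were empty then \<open>y = x\<close>, since they agree outside tight sets; if it
  were \<open>S\<close> then \<open>y\<close> and \<open>x \<le> y\<close> would both sum to \<open>p S\<close>, and again \<open>y = x\<close>.  But \<open>y \<in> Q\<close>, and \<open>x\<close> sums to \<open>p S\<close>, so
  in both cases \<open>x\<close> would be in the M-convex set.
\<close>
lemma largest_tight_set_proper:
  assumes S: "finite S" and p: "integer_supermodular S p" and pS: "p S \<noteq> -\<infinity>"
    and x: "starting_vector S p x" "x \<notin> M_convex_set S p"
    and y: "minimal_vector {y \<in> contra_polyhedron S p \<inter> (S \<rightarrow>\<^sub>E \<int>). x \<le> y} y"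
    and R: "R \<in> tight_sets S p y" "\<forall>X\<in>tight_sets S p y. X \<subseteq> R"
  shows "R \<noteq> {}" "R \<noteq> S"
proof -
  obtain a :: int where xZ: "x \<in> S \<rightarrow>\<^sub>E \<int>" and total: "sum x S = real_of_ereal (p S)"
    using starting_vectorE[OF S x(1)] by metis
  have yZ: "y \<in> S \<rightarrow>\<^sub>E \<int>" and "x \<le> y" and yQ: "\<And>X. X \<subseteq> S \<Longrightarrow> p X \<le> ereal (sum y X)"
    using y by (auto simp: minimal_vector_def contra_polyhedron_def)
  obtain k :: int where k: "p S = ereal (of_int k)"
    using integer_supermodular_cases[OF p order.refl] pS by metis
  have "x \<noteq> y"
    using x(2) xZ total k yQ by (auto simp: M_convex_set_iff)
  moreover have "x = y" if "\<forall>s\<in>S. x s = y s"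
    using that xZ yZ by (intro extensionalityI[of _ S]) (auto simp: PiE_iff)
  ultimately obtain s where s: "s \<in> S" "x s \<noteq> y s"
    by blast
  then have "s \<in> R"
    using minimal_vector_eq_outside_tight_sets[OF S p xZ y s(1)] R(2) by fastforce
  then show "R \<noteq> {}" by auto
  have "x s < y s"
    using s(2) \<open>x \<le> y\<close> by (simp add: le_fun_def less_le)
  then have "sum x S < sum y S"
    using s(1) S \<open>x \<le> y\<close> by (intro sum_strict_mono_ex1) (auto simp: le_fun_def)
  then show "R \<noteq> S"
    using R(1) total k by (auto simp: tight_sets_def)
qed

section \<open>Every run is correct and some run exists\<close>

text \<open>
  The induction carries certificates, and not just least excess, because a certificate of a minor
  turns into one of \<open>p\<close>: it is tight for the set-function of the minor, hence, after adding \<open>R\<close> in the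
  case of the contraction, it is tight for \<open>p\<close>.
\<close>
lemma groenevelt_has_excess_certificate:
  assumes "groenevelt S p z" "finite S" "integer_supermodular S p" "p S \<noteq> -\<infinity>"
  shows "z \<in> M_convex_set S p \<and> (\<forall>c\<in>\<int>. \<exists>X. excess_certificate S p z c X)"
  using assms
proof (induction rule: groenevelt.induct)
  case (stop S p x)
  obtain a :: int where lower: "\<And>s. s \<in> S \<Longrightarrow> of_int a \<le> x s"
    and upper: "\<And>s. s \<in> S \<Longrightarrow> x s \<le> of_int (a + 1)"
    using starting_vectorE[OF stop(3,1)] by metis
  have "\<exists>X. excess_certificate S p x c X" if c: "c \<in> \<int>" for c
  proof -
    obtain i :: int where i: "c = of_int i"
      using c by (auto elim: Ints_cases)
    show ?thesis
    proof (cases "i \<le> a")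
      case True
      then have "of_int i \<le> real_of_int a"
        by simp
      then have "c \<le> x s" if "s \<in> S" for s
        using lower[OF that] i by linarith
      then have "excess_certificate S p x c S"
        using stop(2) by (simp add: excess_certificate_def excess_eq_sum M_convex_set_iff)
      then show ?thesis ..
    next
      case False
      then have "real_of_int (a + 1) \<le> of_int i"
        by (simp del: of_int_add)
      then have "x s \<le> c" if "s \<in> S" for s
        using upper[OF that] i by linarith
      then have "excess_certificate S p x c {}"
        using integer_supermodular_empty[OF stop(4)]
        by (simp add: excess_certificate_def excess_eq_0 zero_ereal_def)
      then show ?thesis ..
    qed
  qed
  with stop show ?case by blast
next
  case (decompose S p x y R T u v)
  note S = \<open>finite S\<close> and p = \<open>integer_supermodular S p\<close>
  let ?q = "contraction S p (S - R)"
  have T: "T = S - R"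
    using decompose by simp
  obtain a :: int where xZ: "x \<in> S \<rightarrow>\<^sub>E \<int>"
    and lower: "\<And>s. s \<in> S \<Longrightarrow> of_int a \<le> x s"
    and upper: "\<And>s. s \<in> S \<Longrightarrow> x s \<le> of_int (a + 1)"
    using starting_vectorE[OF S decompose(1)] by metis
  have yZ: "y \<in> S \<rightarrow>\<^sub>E \<int>" and "x \<le> y" and yQ: "\<And>X. X \<subseteq> S \<Longrightarrow> p X \<le> ereal (sum y X)"
    using decompose(3) by (auto simp: minimal_vector_def contra_polyhedron_def)
  have R: "R \<subseteq> S" and pR: "p R = ereal (sum y R)"
    using decompose(4) by (auto simp: tight_sets_def)
  have finR: "finite R" "finite (S - R)"
    using R S finite_subset by auto
  have "p R \<noteq> -\<infinity>"
    by (simp add: pR)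
  have "?q (S - R) \<noteq> -\<infinity>"
    using \<open>p S \<noteq> -\<infinity>\<close> R pR by (cases "p S") (auto simp: contraction_apply Un_absorb2)
  have u: "u \<in> M_convex_set R (restriction p R)"
    and uc: "\<And>c. c \<in> \<int> \<Longrightarrow> \<exists>X. excess_certificate R (restriction p R) u c X"
    using decompose.IH(1) finR integer_supermodular_restriction[OF p R] pR
    by (auto simp: restriction_apply)
  have v: "v \<in> M_convex_set (S - R) ?q"
    and vc: "\<And>c. c \<in> \<int> \<Longrightarrow> \<exists>X. excess_certificate (S - R) ?q v c X"
    using decompose.IH(2) finR integer_supermodular_contraction[OF p R \<open>p R \<noteq> -\<infinity>\<close>]
      \<open>?q (S - R) \<noteq> -\<infinity>\<close> unfolding T by auto

  \<comment> \<open>On \<open>R\<close>, the vector \<open>y\<close> is a feasible competitor of \<open>u\<close> that never falls below \<open>a\<close>.\<close>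
  have u_ge: "of_int a \<le> u s" if "s \<in> R" for s
  proof -
    have "(\<lambda>s\<in>R. y s) \<in> M_convex_set R (restriction p R)"
    proof -
      have "sum (\<lambda>s\<in>R. y s) X = sum y X" if "X \<subseteq> R" for X
        using that by (intro sum.cong) auto
      then show ?thesis
        using yZ R pR yQ by (auto simp: M_convex_set_iff restriction_apply PiE_iff)
    qed
    then have "excess R u (of_int a) \<le> excess R (\<lambda>s\<in>R. y s) (of_int a)"
      using uc[of "of_int a"] excess_certificate_least[OF finR(1)] by auto
    also have "\<dots> = excess R y (of_int a)"
      unfolding excess_def by (intro sum.cong) auto
    also have "\<dots> = sum y R - of_int a * real (card R)"
    proof (rule excess_eq_sum)
      fix t assume "t \<in> R"
      then have "of_int a \<le> x t"
        using R by (intro lower) auto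
      also have "x t \<le> y t"
        using \<open>x \<le> y\<close> by (simp add: le_fun_def)
      finally show "of_int a \<le> y t" .
    qed
    also have "sum y R = sum u R"
      using u pR by (simp add: M_convex_set_iff restriction_apply)
    finally show ?thesis
      using level_le_if_excess_le_sum[OF finR(1) _ that] by blast
  qed
  \<comment> \<open>Outside \<open>R\<close> the contracted set-function is bounded by \<open>x\<close>, so no certificate for the level
    \<open>a + 1\<close> can account for a positive excess.\<close>
  have v_le: "v s \<le> of_int (a + 1)" if "s \<in> S - R" for s
  proof -
    obtain X where X: "X \<subseteq> S - R"
      and eq: "ereal (excess (S - R) v (of_int (a + 1)) + of_int (a + 1) * real (card X)) = p (X \<union> R) - p R"
      using vc[of "of_int (a + 1)"] by (auto simp: excess_certificate_def contraction_apply[OF R])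
    have finX: "finite X"
      using X S finite_subset by blast
    have "p (X \<union> R) \<le> ereal (sum y (X \<union> R))"
      using X R by (intro yQ) auto
    moreover have "sum y (X \<union> R) = sum y X + sum y R"
      using X finX finR by (intro sum.union_disjoint) auto
    ultimately have "p (X \<union> R) - p R \<le> ereal (sum y X)"
      unfolding pR by (cases "p (X \<union> R)") auto
    also have "sum y X = sum x X"
    proof (intro sum.cong refl)
      fix t assume "t \<in> X"
      then show "y t = x t"
        using X decompose(5) by (intro minimal_vector_eq_outside_tight_sets[OF S p xZ decompose(3)]) auto
    qed
    finally have "excess (S - R) v (of_int (a + 1)) + of_int (a + 1) * real (card X) \<le> sum x X"
      unfolding eq[symmetric] by simp
    also have "\<dots> \<le> (\<Sum>s\<in>X. of_int (a + 1))"
      using X upper by (intro sum_mono) auto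
    finally have "excess (S - R) v (of_int (a + 1)) \<le> 0"
      by (simp add: mult.commute)
    then show ?thesis
      using le_level_if_excess_le_0[OF finR(2) _ that] by blast
  qed

  let ?z = "\<lambda>s\<in>S. if s \<in> R then u s else v s"
  have "\<exists>X. excess_certificate S p ?z c X" if c: "c \<in> \<int>" for c
  proof -
    obtain i :: int where i: "c = of_int i"
      using c by (auto elim: Ints_cases)
    show ?thesis
    proof (cases "i \<le> a")
      case True
      then have "c \<le> of_int a"
        by (simp add: i)
      then have "excess R u c = sum u R - c * real (card R)"
        using u_ge by (intro excess_eq_sum) force
      also have "sum u R = sum y R"
        using u pR by (simp add: M_convex_set_iff restriction_apply)
      finally have exu: "excess R u c = sum y R - c * real (card R)" .
      obtain X where X: "X \<subseteq> S - R"
        and eq: "ereal (excess (S - R) v c + c * real (card X)) = p (X \<union> R) - p R"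
        using vc[OF c] by (auto simp: excess_certificate_def contraction_apply[OF R])
      have "card (X \<union> R) = card X + card R"
        using X S finR by (intro card_Un_disjoint) (auto intro: finite_subset)
      moreover have "p (X \<union> R) = ereal (excess (S - R) v c + c * real (card X) + sum y R)"
        using eq unfolding pR by (cases "p (X \<union> R)") auto
      ultimately have "excess_certificate S p ?z c (X \<union> R)"
        using X R unfolding excess_certificate_def excess_glue[OF S R] exu
        by (auto simp: algebra_simps)
      then show ?thesis ..
    next
      case False
      then have "of_int (a + 1) \<le> c"
        by (simp add: i del: of_int_add)
      then have exv: "excess (S - R) v c = 0"
        using v_le by (intro excess_eq_0) force
      obtain X where "X \<subseteq> R" "ereal (excess R u c + c * real (card X)) = p X"
        using uc[OF c] by (auto simp: excess_certificate_def restriction_apply)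
      then have "excess_certificate S p ?z c X"
        using R unfolding excess_certificate_def excess_glue[OF S R] exv by auto
      then show ?thesis ..
    qed
  qed
  then show ?case
    using M_convex_set_glue[OF S p R \<open>p R \<noteq> -\<infinity>\<close> u v] by blast
qed

lemma groenevelt_run_exists:
  assumes "finite S" "S \<noteq> {}" "integer_supermodular S p" "p S \<noteq> -\<infinity>"
  shows "\<exists>z. groenevelt S p z"
  using assms
proof (induction S arbitrary: p rule: finite_psubset_induct)
  case (psubset S)
  note S = \<open>finite S\<close> and p = \<open>integer_supermodular S p\<close>
  obtain x where x: "starting_vector S p x"
    using starting_vector_exists[OF S psubset(3) p] by blast
  show ?case
  proof (cases "x \<in> M_convex_set S p")
    case True
    then show ?thesis
      using x groenevelt.stop by blast
  next
    case False
    have xZ: "x \<in> S \<rightarrow>\<^sub>E \<int>"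
      using starting_vectorE[OF S x] by metis
    obtain y where y: "minimal_vector {y \<in> contra_polyhedron S p \<inter> (S \<rightarrow>\<^sub>E \<int>). x \<le> y} y"
      using minimal_vector_exists[OF S p xZ] by blast
    then have "y \<in> contra_polyhedron S p"
      by (simp add: minimal_vector_def)
    then obtain R where R: "R \<in> tight_sets S p y" "\<forall>X\<in>tight_sets S p y. X \<subseteq> R"
      using largest_tight_set_exists[OF S p] by blast
    then have RS: "R \<subseteq> S" and pR: "p R = ereal (sum y R)"
      by (auto simp: tight_sets_def)
    have proper: "R \<noteq> {}" "R \<noteq> S"
      using largest_tight_set_proper[OF S p psubset.prems(3) x False y R] by auto
    have fin: "p R \<noteq> -\<infinity>"
      by (simp add: pR)
    have "contraction S p (S - R) (S - R) \<noteq> -\<infinity>"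
      using \<open>p S \<noteq> -\<infinity>\<close> RS pR by (cases "p S") (auto simp: contraction_apply Un_absorb2)
    moreover have "S - R \<subset> S" "S - R \<noteq> {}" "R \<subset> S"
      using RS proper by auto
    ultimately obtain u v where "groenevelt R (restriction p R) u"
      and "groenevelt (S - R) (contraction S p (S - R)) v"
      using psubset.IH[of R "restriction p R"] psubset.IH[of "S - R" "contraction S p (S - R)"]
        integer_supermodular_restriction[OF p RS] integer_supermodular_contraction[OF p RS fin]
        proper fin by (auto simp: restriction_apply)
    then show ?thesis
      using groenevelt.decompose[OF x False y R refl] by blast
  qed
qed

theorem proposition5p2:
  fixes S :: "'a set" and p :: "'a set \<Rightarrow> ereal"
  assumes "finite S" and "S \<noteq> {}"
    and "integer_supermodular S p" and "p S \<noteq> -\<infinity>"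
  shows "(\<exists>z. groenevelt S p z) \<and>
    (\<forall>z. groenevelt S p z \<longrightarrow>
       is_arg_min (square_sum S) (\<lambda>x. x \<in> M_convex_set S p) z \<and>
       decreasingly_minimal S (M_convex_set S p) z)"
proof (intro conjI allI impI)
  show "\<exists>z. groenevelt S p z"
    using groenevelt_run_exists[OF assms] .
next
  fix z assume run: "groenevelt S p z"
  have z: "z \<in> M_convex_set S p"
    and "\<forall>c\<in>\<int>. \<exists>X. excess_certificate S p z c X"
    using groenevelt_has_excess_certificate[OF run assms(1,3,4)] by auto
  then have least: "excess S z c \<le> excess S x c" if "x \<in> M_convex_set S p" "c \<in> \<int>" for x c
    using excess_certificate_least[OF assms(1)] that by blast
  have "square_sum S z \<le> square_sum S x" if x: "x \<in> M_convex_set S p" for x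
  proof (rule square_sum_le_if_excess_le[OF assms(1)])
    show "sum z S = sum x S"
      using x z by (metis M_convex_set_iff ereal.inject)
  qed (use x z least in \<open>auto simp: M_convex_set_iff\<close>)
  then show "is_arg_min (square_sum S) (\<lambda>x. x \<in> M_convex_set S p) z"
    using z by (auto simp: is_arg_min_def not_less)
  show "decreasingly_minimal S (M_convex_set S p) z"
    unfolding decreasingly_minimal_def
    using z least by (auto intro!: lexordp_eq_sorted_if_excess_le[OF assms(1)] simp: M_convex_set_iff)
qed

end
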